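(* Let $n=2t$ with $t\ge 1$ an integer, let $a_1,a_2\in\mathbb{C}$ and $b_1,b_2,c_1,c_2\in\mathbb{C}\setminus\{0\}$, and let $K_n$ be the $n\times n$ pentadiagonal $2$-Toeplitz matrix defined in the context. Let $s$ be a positive integer, or, if $K_n$ is invertible, an arbitrary integer. Then the entries $w_{ij}(s)$ ($1\le i,j\le n$) of $K_n^s$ are $$w_{ij}(s)=\begin{cases}0, & (-1)^{i+j}=-1,\\[4pt] \displaystyle\sum_{z=1}^{n/2} q_{2z-1}\,r_1^{\,l}\,\alpha_{2z-1}^{s}\,B_{i-1}(\alpha_{2z-1})\,B_{j-1}(\alpha_{2z-1}), & (-1)^{i+j}=1,\ j\in\{1,3,\ldots,n-1\},\\[10pt] \displaystyle\sum_{z=1}^{n/2} q_{2z}\,r_2^{\,l}\,\alpha_{2z}^{s}\,A_{i-1}(\alpha_{2z})\,A_{j-1}(\alpha_{2z}), & (-1)^{i+j}=1,\ j\in\{2,4,\ldots,n\},\end{cases}$$ where $r_1=\sqrt{b_1/c_1}$, $r_2=\sqrt{b_2/c_2}$, $l=j-1$ if $j$ is odd and $l=j-2$ if $j$ is even, the numbers $\alpha_1,\dots,\alpha_n$ are $$\alpha_k=\begin{cases} a_1-2\sqrt{b_1c_1}\cos\left(\frac{(k+1)\pi}{n+2}\right), & k \text{ odd},\\ a_2-2\sqrt{b_2c_2}\cos\left(\frac{k\pi}{n+2}\right), & k\text{ even},\end{cases}\qquad 1\le k\le n,$$ and $$q_i=\begin{cases}\dfrac{4-\left(\frac{\alpha_i-a_1}{\sqrt{b_1c_1}}\right)^2}{n+2},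 & i\text{ odd},\\[10pt] \dfrac{4-\left(\frac{\alpha_i-a_2}{\sqrt{b_2c_2}}\right)^2}{n+2}, & i\text{ even},\end{cases}\qquad 1\le i\le n.$$
   Context: The matrix $K_n=(k_{ij})_{1\le i,j\le n}$ has the following entries. For $i$ odd: $k_{ii}=a_1$, $k_{i,i+2}=b_1$ (if $i+2\le n$), $k_{i,i-2}=c_1$ (if $i-2\ge 1$). For $i$ even: $k_{ii}=a_2$, $k_{i,i+2}=b_2$ (if $i+2\le n$), $k_{i,i-2}=c_2$ (if $i-2\ge 1$). All other entries are $0$. The polynomial sequences $(A_i)_{i\ge0}$ and $(B_i)_{i\ge 0}$ in $\mathbb{C}[x]$ are defined by $A_0=0$, $A_1=1$, respectively $B_0=1$, $B_1=0$, and both sequences ($C=A$ or $C=B$) satisfy $xC_0=a_1C_0+b_1C_2$, $\;xC_1=a_2C_1+b_2C_3$, and for $i\ge3$: $xC_{i-1}=c_1C_{i-3}+a_1C_{i-1}+b_1C_{i+1}$ if $i$ is odd, $xC_{i-1}=c_2C_{i-3}+a_2C_{i-1}+b_2C_{i+1}$ if $i$ is even. Square roots denote fixed choices of complex square roots. *)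

theory Defs
  imports "HOL-Analysis.Analysis" "Jordan_Normal_Form.Matrix"
begin

hide_const (open) Module.smult

(* Indices i, j are 1-based here; matrices are 0-based, hence the shift in pent_mat. *)
definition pent_entry ::
  "complex \<Rightarrow> complex \<Rightarrow> complex \<Rightarrow> complex \<Rightarrow> complex \<Rightarrow> complex \<Rightarrow> nat \<Rightarrow> nat \<Rightarrow> complex" where
  "pent_entry a1 a2 b1 b2 c1 c2 i j =
     (if j = i then (if odd i then a1 else a2)
      else if j = i + 2 then (if odd i then b1 else b2)
      else if i = j + 2 then (if odd i then c1 else c2)
      else 0)"

definition pent_mat ::
  "complex \<Rightarrow> complex \<Rightarrow> complex \<Rightarrow> complex \<Rightarrow> complex \<Rightarrow> complex \<Rightarrow> nat \<Rightarrow> complex mat" where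
  "pent_mat a1 a2 b1 b2 c1 c2 n =
     mat n n (\<lambda>(i, j). pent_entry a1 a2 b1 b2 c1 c2 (i + 1) (j + 1))"

(* Integer power in the ring of n x n matrices; for s < 0 it is meaningful only if M is
   invertible. *)
definition mat_int_pow :: "complex mat \<Rightarrow> int \<Rightarrow> complex mat" where
  "mat_int_pow M s = M [^]\<^bsub>ring_mat TYPE(complex) (dim_row M) ()\<^esub> s"

definition pent_rec ::
  "complex \<Rightarrow> complex \<Rightarrow> complex \<Rightarrow> complex \<Rightarrow> complex \<Rightarrow> complex \<Rightarrow> (nat \<Rightarrow> complex poly) \<Rightarrow> bool" where
  "pent_rec a1 a2 b1 b2 c1 c2 C \<longleftrightarrow>
     [:0, 1:] * C 0 = smult a1 (C 0) + smult b1 (C 2) \<and>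
     [:0, 1:] * C 1 = smult a2 (C 1) + smult b2 (C 3) \<and>
     (\<forall>i\<ge>3.
        [:0, 1:] * C (i - 1) =
          (if odd i
           then smult c1 (C (i - 3)) + smult a1 (C (i - 1)) + smult b1 (C (i + 1))
           else smult c2 (C (i - 3)) + smult a2 (C (i - 1)) + smult b2 (C (i + 1))))"

fun pent_poly ::
  "complex \<Rightarrow> complex \<Rightarrow> complex \<Rightarrow> complex \<Rightarrow> complex \<Rightarrow> complex \<Rightarrow>
   complex poly \<Rightarrow> complex poly \<Rightarrow> nat \<Rightarrow> complex poly" where
  "pent_poly a1 a2 b1 b2 c1 c2 p q 0 = p"
| "pent_poly a1 a2 b1 b2 c1 c2 p q (Suc 0) = q"
| "pent_poly a1 a2 b1 b2 c1 c2 p q (Suc (Suc 0)) = smult (1 / b1) ([:- a1, 1:] * p)"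
| "pent_poly a1 a2 b1 b2 c1 c2 p q (Suc (Suc (Suc 0))) = smult (1 / b2) ([:- a2, 1:] * q)"
| "pent_poly a1 a2 b1 b2 c1 c2 p q (Suc (Suc (Suc (Suc m)))) =
     (if even m
      then smult (1 / b1) ([:- a1, 1:] * pent_poly a1 a2 b1 b2 c1 c2 p q (Suc (Suc m))
                           - smult c1 (pent_poly a1 a2 b1 b2 c1 c2 p q m))
      else smult (1 / b2) ([:- a2, 1:] * pent_poly a1 a2 b1 b2 c1 c2 p q (Suc (Suc m))
                           - smult c2 (pent_poly a1 a2 b1 b2 c1 c2 p q m)))"

(* The recurrences and the two initial values determine the sequence, so that it may be
   introduced by hypotheses. *)
lemma pent_rec_ex1:
  assumes b: "b1 \<noteq> 0" "b2 \<noteq> 0"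
  shows "\<exists>!C. pent_rec a1 a2 b1 b2 c1 c2 C \<and> C 0 = p \<and> C 1 = q"
proof (rule ex1I)
  let ?C = "pent_poly a1 a2 b1 b2 c1 c2 p q"
  have lin: "[:- a, 1:] * r = [:0, 1:] * r - smult a r" for a :: complex and r
    by simp
  have step: "[:0, 1:] * ?C (i - 1) =
          (if odd i
           then smult c1 (?C (i - 3)) + smult a1 (?C (i - 1)) + smult b1 (?C (i + 1))
           else smult c2 (?C (i - 3)) + smult a2 (?C (i - 1)) + smult b2 (?C (i + 1)))"
    if "i \<ge> 3" for i
  proof -
    have "\<exists>m. i = Suc (Suc (Suc m))" using that by presburger
    then obtain m where "i = Suc (Suc (Suc m))" ..
    then show ?thesis
      using b by (simp add: lin smult_diff_right del: mult_pCons_left)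
  qed
  show "pent_rec a1 a2 b1 b2 c1 c2 ?C \<and> ?C 0 = p \<and> ?C 1 = q"
    unfolding pent_rec_def using b step
    by (auto simp: lin numeral_2_eq_2 numeral_3_eq_3 simp del: mult_pCons_left)
next
  fix C
  assume C: "pent_rec a1 a2 b1 b2 c1 c2 C \<and> C 0 = p \<and> C 1 = q"
  have solve: "r = smult (1 / b) ([:- a, 1:] * u - v)"
    if "[:0, 1:] * u = v + smult a u + smult b r" "b \<noteq> 0" for a b :: complex and r u v
  proof -
    have "[:- a, 1:] * u - v = smult b r"
      using that(1) by (simp add: algebra_simps)
    then show ?thesis using that(2) by simp
  qed
  have init: "C 0 = p" "C 1 = q"
    and rec2: "[:0, 1:] * C 0 = 0 + smult a1 (C 0) + smult b1 (C 2)"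
    and rec3: "[:0, 1:] * C 1 = 0 + smult a2 (C 1) + smult b2 (C 3)"
    using C unfolding pent_rec_def add_0_left by blast+
  have rec: "[:0, 1:] * C (i - 1) =
          (if odd i
           then smult c1 (C (i - 3)) + smult a1 (C (i - 1)) + smult b1 (C (i + 1))
           else smult c2 (C (i - 3)) + smult a2 (C (i - 1)) + smult b2 (C (i + 1)))"
    if "i \<ge> 3" for i
    using C that unfolding pent_rec_def by blast
  have nat_cases: "n = 0 \<or> n = 1 \<or> n = 2 \<or> n = 3 \<or> (\<exists>m. n = Suc (Suc (Suc (Suc m))))" for n :: nat
    by presburger
  have "C n = pent_poly a1 a2 b1 b2 c1 c2 p q n" for n
  proof (induction n rule: less_induct)
    case (less n)
    consider "n = 0" | "n = 1" | "n = 2" | "n = 3" | m where "n = Suc (Suc (Suc (Suc m)))"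
      using nat_cases[of n] by blast
    then show ?case
    proof cases
      case 3
      then show ?thesis
        using solve[OF rec2 b(1)] init by (simp add: numeral_2_eq_2)
    next
      case 4
      then show ?thesis
        using solve[OF rec3 b(2)] init by (simp add: numeral_3_eq_3)
    next
      case (5 m)
      have r: "[:0, 1:] * C (Suc (Suc m)) =
          (if even m
           then smult c1 (C m) + smult a1 (C (Suc (Suc m))) + smult b1 (C n)
           else smult c2 (C m) + smult a2 (C (Suc (Suc m))) + smult b2 (C n))"
        using rec[of "Suc (Suc (Suc m))"] 5 by (simp del: mult_pCons_left)
      have "C n = (if even m
          then smult (1 / b1) ([:- a1, 1:] * C (Suc (Suc m)) - smult c1 (C m))
          else smult (1 / b2) ([:- a2, 1:] * C (Suc (Suc m)) - smult c2 (C m)))"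
      proof (cases "even m")
        case True
        show ?thesis unfolding if_P[OF True]
          by (rule solve[OF r[unfolded if_P[OF True]] b(1)])
      next
        case False
        show ?thesis unfolding if_not_P[OF False]
          by (rule solve[OF r[unfolded if_not_P[OF False]] b(2)])
      qed
      moreover have "C (Suc (Suc m)) = pent_poly a1 a2 b1 b2 c1 c2 p q (Suc (Suc m))"
        "C m = pent_poly a1 a2 b1 b2 c1 c2 p q m"
        by (rule less, use 5 in simp)+
      ultimately show ?thesis by (simp only: 5 pent_poly.simps)
    qed (use init in auto)
  qed
  then show "C = pent_poly a1 a2 b1 b2 c1 c2 p q" by blast
qed

(* d1 and d2 stand for the chosen square roots of b1 * c1 and b2 * c2. *)
definition pent_alpha ::
  "complex \<Rightarrow> complex \<Rightarrow> complex \<Rightarrow> complex \<Rightarrow> nat \<Rightarrow> nat \<Rightarrow> complex" where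
  "pent_alpha a1 a2 d1 d2 n k =
     (if odd k then a1 - 2 * d1 * complex_of_real (cos (real (k + 1) * pi / real (n + 2)))
      else a2 - 2 * d2 * complex_of_real (cos (real k * pi / real (n + 2))))"

definition pent_q ::
  "complex \<Rightarrow> complex \<Rightarrow> complex \<Rightarrow> complex \<Rightarrow> nat \<Rightarrow> nat \<Rightarrow> complex" where
  "pent_q a1 a2 d1 d2 n i =
     (if odd i then (4 - ((pent_alpha a1 a2 d1 d2 n i - a1) / d1)\<^sup>2) / of_nat (n + 2)
      else (4 - ((pent_alpha a1 a2 d1 d2 n i - a2) / d2)\<^sup>2) / of_nat (n + 2))"

end

theory Submission
  imports Defs "Jordan_Normal_Form.Determinant"
begin

hide_const (open) Module.smult

text \<open>
  The even-indexed and the odd-indexed coordinates decouple, and on each of the two classes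
  \<open>K\<close> acts as a tridiagonal Toeplitz matrix. The polynomials \<open>B\<close> and \<open>A\<close>, rescaled Chebyshev
  polynomials of the second kind, list the coordinates of the eigenvectors, since they vanish at
  the eigenvalues beyond the last row. Discrete orthogonality of the sines
  \<open>sin (k z \<pi> / (t + 1))\<close> shows that the formula gives the identity for \<open>s = 0\<close>, and
  multiplication by \<open>K\<close> raises \<open>s\<close> by one.
\<close>

section \<open>Discrete orthogonality of sines\<close>

text \<open>Multiplication by \<open>2 * sin (x / 2)\<close> makes the sum telescope. The bounds on
  \<open>j\<close> place \<open>x / 2\<close> strictly between 0 and \<pi>, so this factor can be
  cancelled.\<close>

lemma sum_cos_multiples:
  fixes j t :: nat
  assumes "0 < j" "j < 2 * (t + 1)"
  shows "(\<Sum>z=1..t. cos (real j * (real z * pi / real (t + 1)))) = - (1 + (-1) ^ j) / 2"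
proof -
  define x where "x = real j * pi / real (t + 1)"
  have tele: "2 * sin (x / 2) * (\<Sum>z=1..m. cos (real z * x)) = sin (real m * x + x / 2) - sin (x / 2)" for m
  proof (induction m)
    case (Suc m)
    have "sin (real (Suc m) * x + x / 2) - sin (real m * x + x / 2) = 2 * sin (x / 2) * cos (real (Suc m) * x)"
    proof -
      have e: "real m * x + x / 2 = real (Suc m) * x - x / 2" by (simp add: field_simps)
      show ?thesis unfolding e sin_add sin_diff by simp
    qed
    then show ?case using Suc by (simp add: distrib_left)
  qed simp
  have "real (t + 1) * x = real j * pi"
    unfolding x_def by simp
  then have e: "real t * x + x / 2 = real j * pi - x / 2"
    by (simp add: distrib_right)
  have "sin (real t * x + x / 2) = - ((-1) ^ j * sin (x / 2))"
    unfolding e sin_diff by (simp add: cos_npi)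
  with tele[of t] have 1: "2 * sin (x / 2) * (\<Sum>z=1..t. cos (real z * x)) = sin (x / 2) * - (1 + (-1) ^ j)"
    by (simp add: algebra_simps)
  have "real j < 2 * real (t + 1)" using assms(2) by linarith
  then have "x / 2 < pi" unfolding x_def by (simp add: pos_divide_less_eq)
  moreover have "0 < x / 2" using assms(1) unfolding x_def by simp
  ultimately have "sin (x / 2) \<noteq> 0" using sin_gt_zero [of "x / 2"] by linarith
  with 1 have 2: "(\<Sum>z=1..t. cos (real z * x)) = - (1 + (-1) ^ j) / 2"
    by (simp only: mult.assoc mult.left_commute [of 2] mult_left_cancel) simp
  have "real z * x = real j * (real z * pi / real (t + 1))" for z
    unfolding x_def by simp
  with 2 show ?thesis by simp
qed

text \<open>The product formula leaves two cosine sums with multipliers \<open>l - k\<close> and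
  \<open>k + l\<close>. These have the same parity, so the sums cancel, except that for
  \<open>k = l\<close> the first one consists of \<open>t\<close> ones.\<close>

lemma sum_sin_mult_sin:
  fixes k l t :: nat
  assumes "0 < k" "k \<le> t" "0 < l" "l \<le> t"
  shows "(\<Sum>z=1..t. sin (real k * (real z * pi / real (t + 1))) * sin (real l * (real z * pi / real (t + 1)))) =
    (if k = l then real (t + 1) / 2 else 0)"
  using assms
proof (induction k l rule: linorder_wlog)
  case (le k l)
  let ?\<theta> = "\<lambda>z::nat. real z * pi / real (t + 1)"
  have prod: "sin (real k * ?\<theta> z) * sin (real l * ?\<theta> z) =
      (cos (real (l - k) * ?\<theta> z) - cos (real (k + l) * ?\<theta> z)) / 2" for z
  proof -
    have "real (l - k) * ?\<theta> z = real l * ?\<theta> z - real k * ?\<theta> z"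
      using le by (simp add: of_nat_diff left_diff_distrib diff_divide_distrib)
    moreover have "real (k + l) * ?\<theta> z = real k * ?\<theta> z + real l * ?\<theta> z"
      by (simp add: distrib_right add_divide_distrib)
    ultimately show ?thesis by (simp only: cos_diff cos_add) simp
  qed
  have "(\<Sum>z=1..t. sin (real k * ?\<theta> z) * sin (real l * ?\<theta> z)) =
      ((\<Sum>z=1..t. cos (real (l - k) * ?\<theta> z)) - (\<Sum>z=1..t. cos (real (k + l) * ?\<theta> z))) / 2"
    unfolding prod by (simp only: sum_subtractf sum_divide_distrib [symmetric])
  also have "(\<Sum>z=1..t. cos (real (k + l) * ?\<theta> z)) = - (1 + (-1) ^ (k + l)) / 2"
    using le by (intro sum_cos_multiples) auto
  finally have eq: "(\<Sum>z=1..t. sin (real k * ?\<theta> z) * sin (real l * ?\<theta> z)) =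
      ((\<Sum>z=1..t. cos (real (l - k) * ?\<theta> z)) - - (1 + (-1) ^ (k + l)) / 2) / 2" .
  show ?case
  proof (cases "k = l")
    case True
    then show ?thesis unfolding eq by simp
  next
    case False
    have "(\<Sum>z=1..t. cos (real (l - k) * ?\<theta> z)) = - (1 + (-1) ^ (l - k)) / 2"
      using le False by (intro sum_cos_multiples) auto
    moreover have "even (l - k) = even (k + l)" using le by auto
    then have "(-1) ^ (l - k) = ((-1) ^ (k + l) :: real)" by (simp only: uminus_power_if power_one)
    ultimately show ?thesis using False unfolding eq by simp
  qed
next
  case (sym k l)
  then show ?case by (cases "k = l") (simp_all add: mult.commute)
qed

section \<open>Eigenvectors of tridiagonal Toeplitz matrices\<close>

text \<open>If \<open>d\<^sup>2 = b * c\<close> is nonzero, this is \<open>(d / b) ^ m\<close> times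
  the Chebyshev polynomial of the second kind of degree \<open>m\<close> at
  \<open>(x - a) / (2 * d)\<close>.\<close>

fun toeplitz_seq :: "complex \<Rightarrow> complex \<Rightarrow> complex \<Rightarrow> complex \<Rightarrow> nat \<Rightarrow> complex" where
  "toeplitz_seq a b c x 0 = 1"
| "toeplitz_seq a b c x (Suc 0) = (x - a) / b"
| "toeplitz_seq a b c x (Suc (Suc m)) =
     ((x - a) * toeplitz_seq a b c x (Suc m) - c * toeplitz_seq a b c x m) / b"

text \<open>This is the Chebyshev identity expressing \<open>sin ((m + 1) * \<theta>)\<close> as
  \<open>sin \<theta>\<close> times a polynomial in \<open>cos \<theta>\<close>. The minus sign in
  the argument turns the scale \<open>d / b\<close> into \<open>- d / b\<close>. Keeping
  \<open>sin \<theta>\<close> as a factor covers its zeros too.\<close>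

lemma toeplitz_seq_cos:
  fixes a b c d :: complex and \<theta> :: real
  assumes "b \<noteq> 0" "d\<^sup>2 = b * c"
  shows "of_real (sin \<theta>) * toeplitz_seq a b c (a - 2 * d * of_real (cos \<theta>)) m =
    (- d / b) ^ m * of_real (sin (real (m + 1) * \<theta>))"
proof (induction m rule: induct_nat_012)
  case 1
  have "sin (2 * \<theta>) = 2 * sin \<theta> * cos \<theta>" by (rule sin_double)
  then show ?case using assms(1) by (simp add: field_simps)
next
  case (ge2 m)
  define \<rho> where "\<rho> = - d / b"
  define F where "F = toeplitz_seq a b c (a - 2 * d * of_real (cos \<theta>))"
  define S where "S = (\<lambda>k. complex_of_real (sin (real k * \<theta>)))"
  let ?s = "complex_of_real (sin \<theta>)" and ?c = "complex_of_real (cos \<theta>)"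
  \<comment> \<open>In terms of \<open>\<rho>\<close>, both terms of the recurrence carry the common
    factor \<open>\<rho> ^ (m + 2)\<close>, and the addition formula for sines remains.\<close>
  have d: "d = - \<rho> * b" and c: "c = \<rho>\<^sup>2 * b"
    using assms unfolding \<rho>_def by (simp_all add: power2_eq_square field_simps)
  have IH: "?s * F m = \<rho> ^ m * S (m + 1)" "?s * F (Suc m) = \<rho> ^ Suc m * S (m + 2)"
    using ge2 unfolding F_def S_def \<rho>_def by simp_all
  have "sin (real (m + 3) * \<theta>) = 2 * cos \<theta> * sin (real (m + 2) * \<theta>) - sin (real (m + 1) * \<theta>)"
  proof -
    have "real (m + 3) * \<theta> = real (m + 2) * \<theta> + \<theta>" "real (m + 1) * \<theta> = real (m + 2) * \<theta> - \<theta>"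
      by (simp_all add: algebra_simps)
    then show ?thesis by (simp only: sin_add sin_diff) simp
  qed
  then have S: "S (m + 3) = 2 * ?c * S (m + 2) - S (m + 1)"
    unfolding S_def by simp
  have "?s * F (Suc (Suc m)) = (- 2 * d * ?c * (?s * F (Suc m)) - c * (?s * F m)) / b"
    unfolding F_def by (simp add: algebra_simps)
  also have "\<dots> = \<rho> ^ m * \<rho>\<^sup>2 * (2 * ?c * S (m + 2) - S (m + 1))"
    unfolding IH unfolding d c using assms(1) by (simp add: field_simps power2_eq_square)
  also have "\<dots> = \<rho> ^ Suc (Suc m) * S (m + 3)"
    unfolding S by (simp add: power2_eq_square)
  finally show ?case unfolding F_def S_def \<rho>_def by (simp add: eval_nat_numeral)
qed simp

lemma sin_root_pos:
  assumes "1 \<le> z" "z \<le> t"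
  shows "sin (real z * pi / real (t + 1)) > 0"
proof (rule sin_gt_zero)
  have "real z < real (t + 1)" using assms by simp
  then show "real z * pi / real (t + 1) < pi" by (simp add: pos_divide_less_eq)
qed (use assms in simp)

text \<open>Here \<open>t + 1\<close> times the angle is a multiple of \<pi>, while the sine of the
  angle itself is positive. Index \<open>t\<close> is the first one beyond a block of size
  \<open>t\<close>.\<close>

lemma toeplitz_seq_root:
  assumes "b \<noteq> 0" "d\<^sup>2 = b * c" "1 \<le> z" "z \<le> t"
  shows "toeplitz_seq a b c (a - 2 * d * of_real (cos (real z * pi / real (t + 1)))) t = 0"
proof -
  let ?\<theta> = "real z * pi / real (t + 1)"
  have "real (t + 1) * ?\<theta> = real z * pi" by (simp add: field_simps)
  then have "sin (real (t + 1) * ?\<theta>) = 0" by (simp only: sin_npi)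
  then show ?thesis
    using toeplitz_seq_cos [OF assms(1,2), of ?\<theta> a t] sin_root_pos [OF assms(3,4)] by simp
qed

text \<open>The numerator of the weight is four times a squared sine. Each of the two sequence
  values absorbs one of these sines, which leaves the orthogonality sum for sines. The surviving
  case \<open>p = m\<close> is the one in which the powers of \<open>r\<close> cancel the scale
  factors.\<close>

lemma toeplitz_seq_orthogonal:
  fixes a b c d r :: complex
  assumes b: "b \<noteq> 0" and c: "c \<noteq> 0" and d: "d\<^sup>2 = b * c" and r: "r\<^sup>2 = b / c"
    and x: "\<And>z. z \<ge> 1 \<Longrightarrow> x z = a - 2 * d * of_real (cos (real z * pi / real (t + 1)))"
    and p: "p < t" and m: "m < t"
  shows "(\<Sum>z=1..t. (4 - ((x z - a) / d)\<^sup>2) / of_nat (2 * t + 2) * r ^ (2 * m)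
      * toeplitz_seq a b c (x z) p * toeplitz_seq a b c (x z) m) = (if p = m then 1 else 0)"
proof -
  let ?\<theta> = "\<lambda>z::nat. real z * pi / real (t + 1)"
  let ?S = "\<lambda>z. sin (real (p + 1) * ?\<theta> z) * sin (real (m + 1) * ?\<theta> z)"
  define \<rho> where "\<rho> = - d / b"
  define F where "F = (\<lambda>z. toeplitz_seq a b c (x z))"
  have d0: "d \<noteq> 0" using b c d by auto
  \<comment> \<open>Only squares enter, so the choices of the square roots \<open>d\<close> and
    \<open>r\<close> need not be matched.\<close>
  have \<rho>: "\<rho>\<^sup>2 * r\<^sup>2 = 1"
  proof -
    have "\<rho>\<^sup>2 = d\<^sup>2 / b\<^sup>2" unfolding \<rho>_def by (simp add: power_divide)
    then show ?thesis using b c unfolding d r by (simp add: power2_eq_square)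
  qed
  have "(4 - ((x z - a) / d)\<^sup>2) / of_nat (2 * t + 2) * r ^ (2 * m) * F z p * F z m =
      2 / of_nat (t + 1) * (\<rho> ^ p * \<rho> ^ m * r ^ (2 * m)) * of_real (?S z)" if "z \<in> {1..t}" for z
  proof -
    let ?s = "complex_of_real (sin (?\<theta> z))"
    have x: "x z = a - 2 * d * of_real (cos (?\<theta> z))" using that x by simp
    have F: "?s * F z k = \<rho> ^ k * of_real (sin (real (k + 1) * ?\<theta> z))" for k
      unfolding F_def x \<rho>_def by (rule toeplitz_seq_cos [OF b d])
    have "(x z - a) / d = - 2 * of_real (cos (?\<theta> z))" using d0 by (simp add: x)
    then have "4 - ((x z - a) / d)\<^sup>2 = 4 * of_real (1 - (cos (?\<theta> z))\<^sup>2)"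
      by (simp add: power_mult_distrib)
    also have "\<dots> = 4 * ?s\<^sup>2" unfolding sin_squared_eq [symmetric] by simp
    finally have num: "4 - ((x z - a) / d)\<^sup>2 = 4 * ?s\<^sup>2" .
    define N where "N = complex_of_nat (t + 1)"
    have den: "complex_of_nat (2 * t + 2) = 2 * N" unfolding N_def by simp
    have "(4 - ((x z - a) / d)\<^sup>2) / of_nat (2 * t + 2) * r ^ (2 * m) * F z p * F z m =
        2 / N * r ^ (2 * m) * (?s * F z p) * (?s * F z m)"
      unfolding num den by (simp add: power2_eq_square)
    then show ?thesis unfolding F N_def by (simp only: of_real_mult mult_ac)
  qed
  then have "(\<Sum>z=1..t. (4 - ((x z - a) / d)\<^sup>2) / of_nat (2 * t + 2) * r ^ (2 * m) * F z p * F z m) =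
      2 / of_nat (t + 1) * (\<rho> ^ p * \<rho> ^ m * r ^ (2 * m)) * of_real (\<Sum>z=1..t. ?S z)"
    unfolding sum_distrib_left of_real_sum by (rule sum.cong [OF refl])
  also have "(\<Sum>z=1..t. ?S z) = (if p = m then real (t + 1) / 2 else 0)"
    using p m by (subst sum_sin_mult_sin) auto
  also have "2 / of_nat (t + 1) * (\<rho> ^ p * \<rho> ^ m * r ^ (2 * m)) *
      complex_of_real (if p = m then real (t + 1) / 2 else 0) = (if p = m then 1 else 0)"
  proof -
    have "\<rho> ^ m * \<rho> ^ m * r ^ (2 * m) = (\<rho>\<^sup>2 * r\<^sup>2) ^ m"
      by (simp add: power_mult power_mult_distrib power2_eq_square)
    moreover have "complex_of_nat (t + 1) \<noteq> 0" by (simp only: of_nat_eq_0_iff)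
    ultimately show ?thesis using \<rho> by (simp del: of_nat_add of_nat_Suc)
  qed
  finally show ?thesis unfolding F_def .
qed

section \<open>Integer powers from a spectral decomposition\<close>

lemma mat_int_pow_of_nat:
  assumes "M \<in> carrier_mat n n"
  shows "mat_int_pow M (int k) = M ^\<^sub>m k"
proof -
  interpret ring "ring_mat TYPE(complex) n ()" by (rule ring_mat)
  show ?thesis
    using assms unfolding mat_int_pow_def
    by (simp add: int_pow_int pow_mat_ring_pow [where b = "()"])
qed

text \<open>A one-sided inverse of a square matrix is two-sided, so \<open>W\<close> is the ring
  inverse of the \<open>k\<close>-th power.\<close>

lemma mat_int_pow_neg:
  assumes M: "M \<in> carrier_mat n n" and W: "W \<in> carrier_mat n n"
    and k: "k > 0" and MW: "M ^\<^sub>m k * W = 1\<^sub>m n"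
  shows "mat_int_pow M (- int k) = W"
proof -
  interpret ring "ring_mat TYPE(complex) n ()" by (rule ring_mat)
  have P: "M ^\<^sub>m k \<in> carrier_mat n n" using M by simp
  have WM: "W * M ^\<^sub>m k = 1\<^sub>m n" by (rule mat_mult_left_right_inverse [OF P W MW])
  have "W = inv\<^bsub>ring_mat TYPE(complex) n ()\<^esub> (M ^\<^sub>m k)"
    by (rule inv_unique') (use P W MW WM in \<open>simp_all add: ring_mat_simps\<close>)
  then show ?thesis
    using M k unfolding mat_int_pow_def
    by (simp add: int_pow_def2 pow_mat_ring_pow [where b = "()"])
qed

text \<open>The \<open>e z\<close> are eigenvectors and the \<open>f z\<close> a dual family, so the
  candidate \<open>W 0\<close> is the identity. Since \<open>K * W s = W (s + 1)\<close>, powers of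
  \<open>K\<close> lead from \<open>W 0\<close> up to \<open>W s\<close> for
  \<open>s \<ge> 0\<close>, and from \<open>W s\<close> up to \<open>W 0\<close> for
  \<open>s < 0\<close>, which exhibits \<open>W s\<close> as an inverse.\<close>

lemma mat_int_pow_spectral:
  fixes K :: "complex mat" and e f :: "'z \<Rightarrow> nat \<Rightarrow> complex" and x :: "'z \<Rightarrow> complex"
  assumes K: "K \<in> carrier_mat n n"
    and eig: "\<And>z i. z \<in> Z \<Longrightarrow> i < n \<Longrightarrow> (\<Sum>k<n. K $$ (i, k) * e z k) = x z * e z i"
    and id: "\<And>i j. i < n \<Longrightarrow> j < n \<Longrightarrow> (\<Sum>z\<in>Z. e z i * f z j) = (if i = j then 1 else 0)"
    and s: "s \<ge> 0 \<or> invertible_mat K"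
    and ij: "i < n" "j < n"
  shows "mat_int_pow K s $$ (i, j) = (\<Sum>z\<in>Z. x z powi s * e z i * f z j)"
proof -
  define W where "W = (\<lambda>s. mat n n (\<lambda>(i, j). \<Sum>z\<in>Z. x z powi s * e z i * f z j))"
  have Wc: "W s \<in> carrier_mat n n" for s unfolding W_def by simp
  have W0: "W 0 = 1\<^sub>m n" unfolding W_def by (rule eq_matI) (auto simp: id)
  have kernel: "e z i = 0" if inv: "invertible_mat K" and z: "z \<in> Z" "x z = 0" and i: "i < n" for z i
  proof -
    obtain L where KL: "K * L = 1\<^sub>m n" and LK: "L * K = 1\<^sub>m (dim_row L)"
      using inv K unfolding invertible_mat_def inverts_mat_def by auto
    \<comment> \<open>The dimensions of \<open>L\<close> are read off from the column counts of the
      two products.\<close>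
    have L: "L \<in> carrier_mat n n"
      using arg_cong [OF KL, of dim_col] arg_cong [OF LK, of dim_col] K by auto
    \<comment> \<open>Inserting \<open>L * K = 1\<close> and regrouping leaves \<open>L\<close>
      applied to \<open>K\<close> times \<open>e z\<close>, which is zero for eigenvalue 0.\<close>
    have "e z i = (\<Sum>k<n. (L * K) $$ (i, k) * e z k)"
      using LK L i by (simp add: if_distrib [of "\<lambda>u. u * _"] cong: if_cong)
    also have "\<dots> = (\<Sum>k<n. (\<Sum>l<n. L $$ (i, l) * K $$ (l, k)) * e z k)"
      using L K i by (intro sum.cong refl)
        (simp add: scalar_prod_def atLeast0LessThan)
    also have "\<dots> = (\<Sum>l<n. L $$ (i, l) * (\<Sum>k<n. K $$ (l, k) * e z k))"
      unfolding sum_distrib_right sum_distrib_left by (subst sum.swap) (simp add: mult.assoc)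
    also have "\<dots> = 0" using z by (simp add: eig)
    finally show ?thesis .
  qed
  have step: "K * W s = W (s + 1)" if s: "s \<ge> 0 \<or> invertible_mat K" for s
  proof (rule eq_matI)
    fix i j assume "i < dim_row (W (s + 1))" "j < dim_col (W (s + 1))"
    then have ij: "i < n" "j < n" unfolding W_def by simp_all
    \<comment> \<open>Since \<open>0 powi s = 0\<close> for \<open>s < 0\<close>, a zero eigenvalue could break this, but an
      invertible \<open>K\<close> has no kernel.\<close>
    have pw: "x z * x z powi s * e z i = x z powi (s + 1) * e z i" if "z \<in> Z" for z
    proof (cases "x z = 0")
      case True
      then show ?thesis
        using s kernel [of z i] that ij by (auto simp: power_int_0_left_if)
    next
      case False
      then show ?thesis by (simp add: power_int_add)
    qed
    have "(K * W s) $$ (i, j) = (\<Sum>k<n. K $$ (i, k) * (\<Sum>z\<in>Z. x z powi s * e z k * f z j))"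
      using K ij unfolding W_def by (simp add: scalar_prod_def atLeast0LessThan)
    also have "\<dots> = (\<Sum>z\<in>Z. x z powi s * f z j * (\<Sum>k<n. K $$ (i, k) * e z k))"
      unfolding sum_distrib_left by (subst sum.swap) (simp add: mult_ac)
    also have "\<dots> = (\<Sum>z\<in>Z. x z powi (s + 1) * e z i * f z j)"
      by (intro sum.cong refl) (simp add: eig ij pw [symmetric])
    finally show "(K * W s) $$ (i, j) = W (s + 1) $$ (i, j)"
      using ij unfolding W_def by simp
  qed (use K in \<open>auto simp: W_def\<close>)
  have pow: "K ^\<^sub>m k * W s = W (s + int k)" if s: "s \<ge> 0 \<or> invertible_mat K" for k s
    using s
  proof (induction k arbitrary: s)
    case 0
    then show ?case using K Wc [of s] by simp
  next
    case (Suc k)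
    have "K ^\<^sub>m Suc k * W s = K ^\<^sub>m k * (K * W s)"
      using K Wc [of s] by (simp add: assoc_mult_mat [of _ n n _ n _ n])
    also have "\<dots> = W (s + 1 + int k)"
      using Suc.prems by (subst step) (auto intro!: Suc.IH)
    finally show ?case by (simp add: add_ac)
  qed
  have "mat_int_pow K s = W s"
  proof (cases "s \<ge> 0")
    case True
    then have "K ^\<^sub>m nat s = W s" using pow [of 0 "nat s"] K by (simp add: W0)
    then show ?thesis using mat_int_pow_of_nat [OF K, of "nat s"] True by simp
  next
    case False
    then have "K ^\<^sub>m nat (- s) * W s = 1\<^sub>m n" using pow [of s "nat (- s)"] s by (simp add: W0)
    then show ?thesis using mat_int_pow_neg [OF K Wc, of "nat (- s)"] False by simp
  qed
  then show ?thesis using ij unfolding W_def by simp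
qed

section \<open>The eigenvectors of \<open>K\<close>\<close>

text \<open>All the recurrences take one form, indexed by the 0-based row; parities are therefore
  swapped relative to \<open>pent_rec\<close>. The guard \<open>i < 2\<close> replaces the missing
  lower term.\<close>

lemma poly_pent_rec:
  assumes "pent_rec a1 a2 b1 b2 c1 c2 C"
  shows "x * poly (C i) x = (if i < 2 then 0 else (if even i then c1 else c2) * poly (C (i - 2)) x)
    + (if even i then a1 else a2) * poly (C i) x + (if even i then b1 else b2) * poly (C (i + 2)) x"
proof -
  consider "i = 0" | "i = 1" | "i \<ge> 2" by linarith
  then show ?thesis
  proof cases
    case 1
    have "[:0, 1:] * C 0 = smult a1 (C 0) + smult b1 (C 2)"
      using assms unfolding pent_rec_def by blast
    from arg_cong [OF this, of "\<lambda>p. poly p x"] 1 show ?thesis by (simp add: numeral_2_eq_2)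
  next
    case 2
    have "[:0, 1:] * C 1 = smult a2 (C 1) + smult b2 (C 3)"
      using assms unfolding pent_rec_def by blast
    from arg_cong [OF this, of "\<lambda>p. poly p x"] 2 show ?thesis by (simp add: numeral_3_eq_3)
  next
    case 3
    then have "i + 1 \<ge> 3" by simp
    then have "[:0, 1:] * C (i + 1 - 1) =
          (if odd (i + 1)
           then smult c1 (C (i + 1 - 3)) + smult a1 (C (i + 1 - 1)) + smult b1 (C (i + 1 + 1))
           else smult c2 (C (i + 1 - 3)) + smult a2 (C (i + 1 - 1)) + smult b2 (C (i + 1 + 1)))"
      using assms unfolding pent_rec_def by blast
    moreover have "i + 1 - 3 = i - 2" using 3 by simp
    ultimately have "[:0, 1:] * C i =
          (if even i
           then smult c1 (C (i - 2)) + smult a1 (C i) + smult b1 (C (i + 2))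
           else smult c2 (C (i - 2)) + smult a2 (C i) + smult b2 (C (i + 2)))"
      by (simp del: mult_pCons_left)
    from arg_cong [OF this, of "\<lambda>p. poly p x"] 3 show ?thesis by simp
  qed
qed

text \<open>The recurrence steps by two, so the even indices form a tridiagonal system of their own,
  determined by \<open>C 0\<close>. In particular they all vanish for \<open>A\<close>.\<close>

lemma poly_pent_rec_even:
  assumes "pent_rec a1 a2 b1 b2 c1 c2 C" "b1 \<noteq> 0"
  shows "poly (C (2 * m)) x = poly (C 0) x * toeplitz_seq a1 b1 c1 x m"
proof (induction m rule: induct_nat_012)
  case 1
  then show ?case
    using poly_pent_rec [OF assms(1), of x 0] assms(2) by (simp add: field_simps)
next
  case (ge2 m)
  have "x * poly (C (2 * Suc m)) x = c1 * poly (C (2 * m)) x + a1 * poly (C (2 * Suc m)) x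
      + b1 * poly (C (2 * Suc (Suc m))) x"
    using poly_pent_rec [OF assms(1), of x "2 * Suc m"] by simp
  then have "poly (C (2 * Suc (Suc m))) x =
      ((x - a1) * poly (C (2 * Suc m)) x - c1 * poly (C (2 * m)) x) / b1"
    using assms(2) by (simp add: field_simps)
  then show ?case unfolding ge2 by (simp add: algebra_simps)
qed simp

text \<open>The odd indices decouple in the same way and are determined by \<open>C 1\<close>; they
  vanish for \<open>B\<close>.\<close>

lemma poly_pent_rec_odd:
  assumes "pent_rec a1 a2 b1 b2 c1 c2 C" "b2 \<noteq> 0"
  shows "poly (C (2 * m + 1)) x = poly (C 1) x * toeplitz_seq a2 b2 c2 x m"
proof (induction m rule: induct_nat_012)
  case 1
  then show ?case
    using poly_pent_rec [OF assms(1), of x 1] assms(2) by (simp add: field_simps)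
next
  case (ge2 m)
  have "x * poly (C (2 * Suc m + 1)) x = c2 * poly (C (2 * m + 1)) x + a2 * poly (C (2 * Suc m + 1)) x
      + b2 * poly (C (2 * Suc (Suc m) + 1)) x"
    using poly_pent_rec [OF assms(1), of x "2 * Suc m + 1"] by simp
  then have "poly (C (2 * Suc (Suc m) + 1)) x =
      ((x - a2) * poly (C (2 * Suc m + 1)) x - c2 * poly (C (2 * m + 1)) x) / b2"
    using assms(2) by (simp add: field_simps)
  then show ?case unfolding ge2 by (simp add: algebra_simps)
qed simp

text \<open>Row \<open>i\<close> of the matrix reproduces the recurrence at \<open>i\<close>, apart
  from terms cut off at the right edge, and \<open>root\<close> makes those terms zero.\<close>

lemma pent_mat_mult_poly:
  assumes C: "pent_rec a1 a2 b1 b2 c1 c2 C"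
    and root: "poly (C n) x = 0" "poly (C (n + 1)) x = 0" and i: "i < n"
  shows "(\<Sum>k<n. pent_mat a1 a2 b1 b2 c1 c2 n $$ (i, k) * poly (C k) x) = x * poly (C i) x"
proof -
  define g where "g = (\<lambda>k. pent_entry a1 a2 b1 b2 c1 c2 (i + 1) (k + 1) * poly (C k) x)"
  have "(\<Sum>k<n. pent_mat a1 a2 b1 b2 c1 c2 n $$ (i, k) * poly (C k) x) = (\<Sum>k<n. g k)"
    using i by (simp add: pent_mat_def g_def)
  \<comment> \<open>With the two extra columns, the last two rows need no separate
    treatment.\<close>
  also have "\<dots> = (\<Sum>k<n + 2. g k)" using root by (simp add: g_def)
  also have "\<dots> = x * poly (C i) x"
  proof (cases "i < 2")
    case True
    have "(\<Sum>k<n + 2. g k) = (\<Sum>k\<in>{i, i + 2}. g k)"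
      using i True by (intro sum.mono_neutral_right) (auto simp: g_def pent_entry_def)
    also have "\<dots> = x * poly (C i) x"
      using True unfolding poly_pent_rec [OF C, of x i]
      by (simp add: g_def pent_entry_def)
    finally show ?thesis .
  next
    case False
    then obtain m where m: "i = m + 2" by (metis add.commute le_add_diff_inverse2 not_less)
    have "(\<Sum>k<n + 2. g k) = (\<Sum>k\<in>{m, Suc (Suc m), Suc (Suc (Suc (Suc m)))}. g k)"
      using i by (intro sum.mono_neutral_right) (auto simp: g_def pent_entry_def m)
    also have "\<dots> = x * poly (C i) x"
      unfolding poly_pent_rec [OF C, of x i]
      by (simp add: g_def pent_entry_def m)
    finally show ?thesis .
  qed
  finally show ?thesis .
qed

section \<open>Combining the two parity classes into the formula for the powers\<close>

lemma sum_split_parity: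
  fixes g :: "nat \<Rightarrow> 'a::comm_monoid_add"
  shows "(\<Sum>z=1..2 * t. g z) = (\<Sum>z=1..t. g (2 * z - 1)) + (\<Sum>z=1..t. g (2 * z))"
  by (induction t) (simp_all add: add_ac)

theorem mainTheorem1:
  fixes a1 a2 b1 b2 c1 c2 d1 d2 r1 r2 :: complex
    and n t :: nat and s :: int
    and K :: "complex mat"
    and A B :: "nat \<Rightarrow> complex poly"
    and \<alpha> q :: "nat \<Rightarrow> complex"
  assumes "n = 2 * t" and "t \<ge> 1"
    and "b1 \<noteq> 0" and "b2 \<noteq> 0" and "c1 \<noteq> 0" and "c2 \<noteq> 0"
    and "K = pent_mat a1 a2 b1 b2 c1 c2 n"
    and "s > 0 \<or> invertible_mat K"
    and "d1\<^sup>2 = b1 * c1" and "d2\<^sup>2 = b2 * c2"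
    and "r1\<^sup>2 = b1 / c1" and "r2\<^sup>2 = b2 / c2"
    and "pent_rec a1 a2 b1 b2 c1 c2 A" and "A 0 = 0" and "A 1 = 1"
    and "pent_rec a1 a2 b1 b2 c1 c2 B" and "B 0 = 1" and "B 1 = 0"
    and "\<alpha> = pent_alpha a1 a2 d1 d2 n"
    and "q = pent_q a1 a2 d1 d2 n"
  shows "\<forall>i\<in>{1..n}. \<forall>j\<in>{1..n}.
    mat_int_pow K s $$ (i - 1, j - 1) =
      (let l = (if odd j then j - 1 else j - 2) in
       if (-1 :: int) ^ (i + j) = -1 then 0
       else if odd j then
         (\<Sum>z = 1..n div 2. q (2 * z - 1) * r1 ^ l * \<alpha> (2 * z - 1) powi s
            * poly (B (i - 1)) (\<alpha> (2 * z - 1)) * poly (B (j - 1)) (\<alpha> (2 * z - 1)))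
       else
         (\<Sum>z = 1..n div 2. q (2 * z) * r2 ^ l * \<alpha> (2 * z) powi s
            * poly (A (i - 1)) (\<alpha> (2 * z)) * poly (A (j - 1)) (\<alpha> (2 * z))))"
proof -
  note nt = assms(1) and nz = assms(3-6) and K = assms(7) and s = assms(8)
    and d = assms(9,10) and r = assms(11,12)
  note A = assms(13) and B = assms(16)
  let ?x1 = "\<lambda>z. \<alpha> (2 * z - 1)" and ?x2 = "\<lambda>z. \<alpha> (2 * z)"
  let ?U1 = "toeplitz_seq a1 b1 c1" and ?U2 = "toeplitz_seq a2 b2 c2"
  have B_even: "poly (B (2 * m)) y = ?U1 y m" and B_odd: "poly (B (2 * m + 1)) y = 0"
    and A_even: "poly (A (2 * m)) y = 0" and A_odd: "poly (A (2 * m + 1)) y = ?U2 y m" for m y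
    using poly_pent_rec_even [OF B, of m y] poly_pent_rec_odd [OF B, of m y]
      poly_pent_rec_even [OF A, of m y] poly_pent_rec_odd [OF A, of m y] assms(14,15,17,18) nz
    by auto
  \<comment> \<open>Since \<open>n + 2 = 2 * (t + 1)\<close>, both kinds of eigenvalue use the
    angles of a block of size \<open>t\<close>.\<close>
  have angle: "real (2 * z) * pi / real (n + 2) = real z * pi / real (t + 1)" for z
    using nt by (simp add: field_simps)
  \<comment> \<open>At \<open>z = 0\<close> truncated subtraction would give the even index 0, hence
    the restriction \<open>z \<ge> 1\<close>.\<close>
  have x1: "?x1 z = a1 - 2 * d1 * of_real (cos (real z * pi / real (t + 1)))"
    and q1: "q (2 * z - 1) = (4 - ((?x1 z - a1) / d1)\<^sup>2) / of_nat (2 * t + 2)" if "z \<ge> 1" for z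
  proof -
    have "odd (2 * z - 1)" "2 * z - 1 + 1 = 2 * z" using that by auto
    then show "?x1 z = a1 - 2 * d1 * of_real (cos (real z * pi / real (t + 1)))"
      "q (2 * z - 1) = (4 - ((?x1 z - a1) / d1)\<^sup>2) / of_nat (2 * t + 2)"
      unfolding assms(19,20) pent_alpha_def pent_q_def angle [symmetric] nt by simp_all
  qed
  have x2: "?x2 z = a2 - 2 * d2 * of_real (cos (real z * pi / real (t + 1)))"
    and q2: "q (2 * z) = (4 - ((?x2 z - a2) / d2)\<^sup>2) / of_nat (2 * t + 2)" for z
    unfolding assms(19,20) pent_alpha_def pent_q_def angle [symmetric] nt by simp_all
  have orth1: "(\<Sum>z=1..t. q (2 * z - 1) * r1 ^ (2 * m) * ?U1 (?x1 z) p * ?U1 (?x1 z) m) =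
      (if p = m then 1 else 0)" if "p < t" "m < t" for p m
  proof -
    have "(\<Sum>z=1..t. q (2 * z - 1) * r1 ^ (2 * m) * ?U1 (?x1 z) p * ?U1 (?x1 z) m) =
        (\<Sum>z=1..t. (4 - ((?x1 z - a1) / d1)\<^sup>2) / of_nat (2 * t + 2) * r1 ^ (2 * m) * ?U1 (?x1 z) p * ?U1 (?x1 z) m)"
      by (intro sum.cong refl) (simp only: q1 atLeastAtMost_iff)
    also have "\<dots> = (if p = m then 1 else 0)"
      by (rule toeplitz_seq_orthogonal [OF nz(1) nz(3) d(1) r(1) x1 that])
    finally show ?thesis .
  qed
  have orth2: "(\<Sum>z=1..t. q (2 * z) * r2 ^ (2 * m) * ?U2 (?x2 z) p * ?U2 (?x2 z) m) =
      (if p = m then 1 else 0)" if "p < t" "m < t" for p m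
    unfolding q2 by (rule toeplitz_seq_orthogonal [OF nz(2) nz(4) d(2) r(2) x2 that])
  define C where "C = (\<lambda>z::nat. if odd z then B else A)"
  define e where "e = (\<lambda>z i. poly (C z i) (\<alpha> z))"
  \<comment> \<open>The dual family is the eigenvectors rescaled. With \<open>j\<close> 0-based, the
    exponents are the \<open>l\<close> of the theorem; on the supports of \<open>B\<close> and
    \<open>A\<close> both equal \<open>2 * m\<close>, for \<open>j = 2 * m\<close> and
    \<open>j = 2 * m + 1\<close> respectively.\<close>
  define f where "f = (\<lambda>z j. q z * (if odd z then r1 ^ j else r2 ^ (j - 1)) * e z j)"
  have eig: "(\<Sum>k<n. K $$ (i, k) * e z k) = \<alpha> z * e z i" if z: "z \<in> {1..n}" and i: "i < n" for z i
    unfolding e_def K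
  proof (rule pent_mat_mult_poly [OF _ _ _ i])
    show "pent_rec a1 a2 b1 b2 c1 c2 (C z)" using A B by (simp add: C_def)
    \<comment> \<open>Since \<open>n\<close> is even, one of the two values vanishes by parity and
      the other is \<open>toeplitz_seq\<close> at index \<open>t\<close>, evaluated at a
      root.\<close>
    have "poly (C z n) (\<alpha> z) = 0 \<and> poly (C z (n + 1)) (\<alpha> z) = 0"
    proof (cases "odd z")
      case True
      then obtain k where "z = 2 * k + 1" by (rule oddE)
      then have k: "z = 2 * (k + 1) - 1" "1 \<le> k + 1" "k + 1 \<le> t" using z nt by auto
      have "?U1 (\<alpha> z) t = 0"
        unfolding k(1) x1 [OF k(2)] by (rule toeplitz_seq_root [OF nz(1) d(1) k(2,3)])
      then show ?thesis using True B_even [of t] B_odd [of t] by (simp add: C_def nt)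
    next
      case False
      then obtain k where "z = 2 * k" by auto
      then have k: "z = 2 * k" "1 \<le> k" "k \<le> t" using z nt by auto
      have "?U2 (\<alpha> z) t = 0"
        unfolding k(1) x2 by (rule toeplitz_seq_root [OF nz(2) d(2) k(2,3)])
      then show ?thesis using False A_even [of t] A_odd [of t] by (simp add: C_def nt)
    qed
    then show "poly (C z n) (\<alpha> z) = 0" "poly (C z (n + 1)) (\<alpha> z) = 0" by blast+
  qed
  \<comment> \<open>The free weight \<open>w\<close> serves twice: constant 1 for the identity
    matrix and \<open>\<alpha> z powi s\<close> for the power. Odd \<open>z\<close> contribute only
    if \<open>i\<close> and \<open>j\<close> are both even, even \<open>z\<close> only if both are
    odd.\<close>
  have split: "(\<Sum>z=1..n. w z * e z i * f z j) =
     (if odd i \<longleftrightarrow> odd j then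
        if even j then \<Sum>z=1..t. q (2 * z - 1) * r1 ^ j * w (2 * z - 1) * poly (B i) (?x1 z) * poly (B j) (?x1 z)
        else \<Sum>z=1..t. q (2 * z) * r2 ^ (j - 1) * w (2 * z) * poly (A i) (?x2 z) * poly (A j) (?x2 z)
      else 0)" for w i j
  proof -
    have 1: "(\<Sum>z=1..t. w (2 * z - 1) * e (2 * z - 1) i * f (2 * z - 1) j) =
        (\<Sum>z=1..t. q (2 * z - 1) * r1 ^ j * w (2 * z - 1) * poly (B i) (?x1 z) * poly (B j) (?x1 z))"
      by (intro sum.cong refl) (auto simp: e_def f_def C_def)
    have 2: "(\<Sum>z=1..t. w (2 * z) * e (2 * z) i * f (2 * z) j) =
        (\<Sum>z=1..t. q (2 * z) * r2 ^ (j - 1) * w (2 * z) * poly (A i) (?x2 z) * poly (A j) (?x2 z))"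
      by (intro sum.cong refl) (auto simp: e_def f_def C_def)
    have B0: "poly (B k) y = 0" if "odd k" for k y using that B_odd by (auto elim!: oddE)
    have A0: "poly (A k) y = 0" if "even k" for k y using that A_even by (auto elim!: evenE)
    show ?thesis unfolding nt sum_split_parity 1 2 using A0 B0 by auto
  qed
  have id: "(\<Sum>z=1..n. e z i * f z j) = (if i = j then 1 else 0)" if ij: "i < n" "j < n" for i j
  proof -
    have *: "(\<Sum>z=1..n. e z i * f z j) = (\<Sum>z=1..n. 1 * e z i * f z j)" by simp
    consider "odd i \<noteq> odd j" | "even i" "even j" | "odd i" "odd j" by blast
    then show ?thesis
    proof cases
      case 1
      then show ?thesis unfolding * split by auto
    next
      case 2
      then obtain p m where pm: "i = 2 * p" "j = 2 * m" by (auto elim!: evenE)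
      then have "p < t" "m < t" using ij nt by auto
      then show ?thesis
        unfolding * split using orth1 [of p m] by (simp add: pm B_even)
    next
      case 3
      then obtain p m where pm: "i = 2 * p + 1" "j = 2 * m + 1" by (auto elim!: oddE)
      then have "p < t" "m < t" using ij nt by auto
      then show ?thesis
        unfolding * split using orth2 [of p m] by (simp add: pm A_odd [simplified])
    qed
  qed
  show ?thesis
  proof (intro ballI)
    fix i j assume ij: "i \<in> {1..n}" "j \<in> {1..n}"
    have Kc: "K \<in> carrier_mat n n" unfolding K pent_mat_def by simp
    have "mat_int_pow K s $$ (i - 1, j - 1) = (\<Sum>z=1..n. \<alpha> z powi s * e z (i - 1) * f z (j - 1))"
      using s ij by (intro mat_int_pow_spectral [OF Kc eig id]) auto
    \<comment> \<open>Passing to 1-based indices flips parity, so odd \<open>j\<close> selects the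
      sum over \<open>B\<close>.\<close>
    moreover have "odd (i - 1) \<longleftrightarrow> even i" "odd (j - 1) \<longleftrightarrow> even j" using ij by auto
    moreover have "(-1 :: int) ^ (i + j) = -1 \<longleftrightarrow> odd i \<noteq> odd j" by (simp add: uminus_power_if)
    moreover have "n div 2 = t" "j - 1 - 1 = j - 2" using nt by auto
    ultimately show "mat_int_pow K s $$ (i - 1, j - 1) =
      (let l = (if odd j then j - 1 else j - 2) in
       if (-1 :: int) ^ (i + j) = -1 then 0
       else if odd j then
         (\<Sum>z = 1..n div 2. q (2 * z - 1) * r1 ^ l * \<alpha> (2 * z - 1) powi s
            * poly (B (i - 1)) (\<alpha> (2 * z - 1)) * poly (B (j - 1)) (\<alpha> (2 * z - 1)))
       else
         (\<Sum>z = 1..n div 2. q (2 * z) * r2 ^ l * \<alpha> (2 * z) powi s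
            * poly (A (i - 1)) (\<alpha> (2 * z)) * poly (A (j - 1)) (\<alpha> (2 * z))))"
      unfolding split Let_def using ij by simp
  qed
qed

end
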